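(* Let $N\ge1$, let $\underline{m}=(m_1,\dots,m_N)\in\mathbb{N}_{\ge3}^N$, and let $h:\mathbb{Z}^N\to\mathbb{Z}$ be the map $$h(x_1,\dots,x_N)=\binom{x_1}{m_1}\cdots\binom{x_N}{m_N}.$$ Let $\underline{n}=(n_1,\dots,n_N)\in\mathbb{N}_{\ge2}^N$ be such that $n_i<m_i$ for each $1\le i\le N$. Then for each $\underline{x}=(x_1,\dots,x_N)\in\mathbb{Z}^N$, $$\sum_{0\le p_1\le n_1;\ \cdots;\ 0\le p_N\le n_N}(-1)^{p_1+\cdots+p_N}\binom{n_1}{p_1}\cdots\binom{n_N}{p_N}\,h\Bigl(\sum_{i=1}^N(n_i-p_i+x_i)e_i\Bigr)=\prod_{l=1}^N\binom{x_l}{m_l-n_l}.$$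
   Context: $e_1,\dots,e_N$ is the standard basis of $\mathbb{Z}^N$. $\mathbb{N}_{\ge k}$ denotes the integers $\ge k$. For $x\in\mathbb{Z}$ and $k\in\mathbb{N}$, $\binom{x}{k}=x(x-1)\cdots(x-k+1)/k!$, with $\binom{x}{0}=1$. *)

theory Defs
  imports "HOL-Analysis.Finite_Cartesian_Product"
begin

text \<open>
  \<open>\<int>\<^sup>N\<close> is the type \<open>int ^ 'N\<close> with standard basis \<open>axis i 1\<close>; the finite index type \<open>'N\<close>
  is nonempty, so \<open>N \<ge> 1\<close> is implicit.

  The constant \<^const>\<open>gbinomial\<close> exists at type \<^typ>\<open>int\<close>, but below \<^theory>\<open>Complex_Main\<close> its
  parsing is constrained to fields, so that \<open>gchoose\<close> applied to an integer is silently read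
  over the reals. The following is its instance at \<^typ>\<open>int\<close>; the division is exact.
\<close>

definition int_gbinomial :: "int \<Rightarrow> nat \<Rightarrow> int"  (infix \<open>zchoose\<close> 64)
  where "x zchoose k = (\<Prod>i = 0..<k. x - int i) div fact k"

lemmas int_gbinomial_eq_gbinomial = trans [OF int_gbinomial_def gbinomial_prod_rev [where 'a = int, symmetric]]

lemma fact_mult_int_gbinomial: "fact k * (x zchoose k) = (\<Prod>i = 0..<k. x - int i)"
  by (simp only: int_gbinomial_eq_gbinomial gbinomial_int_mult_fact)

lemma of_int_int_gbinomial: "of_int (x zchoose k) = (of_int x :: 'a::field_char_0) gchoose k"
  by (simp only: int_gbinomial_eq_gbinomial of_int_gbinomial)

end

theory Submission
  imports Defs
begin

text \<open>The alternating sum is an iterated forward difference of \<open>h\<close>, taken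
  \<open>n $ i\<close> times in direction \<open>i\<close>. As \<open>h\<close> is a product of
  one-variable functions, the sum factors over the coordinates (\<open>sum_vec_prod\<close>). In one
  variable, Pascal's rule says that a forward difference lowers the lower index of a binomial
  coefficient by one, so \<open>n\<close> of them turn \<open>m\<close> into \<open>m - n\<close>
  (\<open>binomial_difference_int_gbinomial\<close>).\<close>

lemma int_gbinomial_Suc_Suc: "(x + 1) zchoose Suc k = (x zchoose k) + (x zchoose Suc k)"
proof -
  have "(of_int ((x + 1) zchoose Suc k) :: real) = of_int ((x zchoose k) + (x zchoose Suc k))"
    by (simp add: of_int_int_gbinomial gbinomial_Suc_Suc)
  then show ?thesis
    by (simp only: of_int_eq_iff)
qed

text \<open>The difference of order \<open>Suc n\<close> of \<open>f\<close> is the difference of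
  order \<open>n\<close> of y \<mapsto> f (y + 1) - f y. This allows induction on the order.\<close>

lemma binomial_difference_Suc:
  fixes f :: "int \<Rightarrow> 'a::comm_ring_1"
  shows "(\<Sum>p\<le>Suc n. (- 1) ^ p * of_nat (Suc n choose p) * f (int (Suc n) - int p + x))
       = (\<Sum>p\<le>n. (- 1) ^ p * of_nat (n choose p)
            * (f (int n - int p + x + 1) - f (int n - int p + x)))"
proof -
  let ?s = "\<lambda>p. (- 1) ^ p * of_nat (n choose p) * f (int n - int p + x)"
  let ?t = "\<lambda>p. (- 1) ^ p * of_nat (n choose p) * f (int n - int p + x + 1)"
  have "(\<Sum>p\<le>Suc n. (- 1) ^ p * of_nat (Suc n choose p) * f (int (Suc n) - int p + x))
      = ?t 0 + (\<Sum>p\<le>n. ?t (Suc p) - ?s p)"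
    \<comment> \<open>Pascal's rule splits \<open>Suc n choose Suc p\<close>: the part
      \<open>n choose Suc p\<close> gives \<open>?t (Suc p)\<close>, and the part
      \<open>n choose p\<close>, with its sign flipped, gives \<open>- ?s p\<close>.\<close>
    by (subst sum.atMost_Suc_shift) (simp add: algebra_simps sum.distrib sum_subtractf sum_negf)
  also have "\<dots> = (?t 0 + (\<Sum>p\<le>n. ?t (Suc p))) - (\<Sum>p\<le>n. ?s p)"
    by (simp add: sum_subtractf)
  also have "?t 0 + (\<Sum>p\<le>n. ?t (Suc p)) = (\<Sum>p\<le>Suc n. ?t p)"
    by (rule sum.atMost_Suc_shift [symmetric])
  \<comment> \<open>The top term vanishes since \<open>n choose Suc n\<close> is 0.\<close>
  also have "\<dots> = (\<Sum>p\<le>n. ?t p)"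
    by (simp add: binomial_eq_0)
  finally show ?thesis
    by (simp add: sum_subtractf right_diff_distrib)
qed

text \<open>Each induction step takes one forward difference and passes from \<open>Suc k\<close> to
  \<open>k\<close>, hence \<open>m\<close> is arbitrary; \<open>n \<le> m\<close> keeps
  \<open>m\<close> a successor there.\<close>

lemma binomial_difference_int_gbinomial:
  assumes "n \<le> m"
  shows "(\<Sum>p\<le>n. (- 1) ^ p * int (n choose p) * ((int n - int p + x) zchoose m))
       = x zchoose (m - n)"
  using assms
proof (induction n arbitrary: m)
  case 0
  then show ?case by simp
next
  case (Suc n)
  then obtain k where m: "m = Suc k" and "n \<le> k"
    by (cases m) auto
  have "(\<Sum>p\<le>Suc n. (- 1) ^ p * int (Suc n choose p) * ((int (Suc n) - int p + x) zchoose m))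
      = (\<Sum>p\<le>n. (- 1) ^ p * int (n choose p) * ((int n - int p + x) zchoose k))"
    by (subst binomial_difference_Suc) (simp add: m int_gbinomial_Suc_Suc)
  with Suc.IH [OF \<open>n \<le> k\<close>] show ?case
    by (simp add: m)
qed

text \<open>Distributivity: expanding a product of sums means choosing one summand per coordinate,
  and a vector records such a choice.\<close>

lemma sum_vec_prod:
  fixes f :: "'n::finite \<Rightarrow> 'b \<Rightarrow> 'a::comm_semiring_1"
  assumes "\<And>i. finite (A i)"
  shows "(\<Sum>p | \<forall>i. p $ i \<in> A i. \<Prod>i\<in>UNIV. f i (p $ i)) = (\<Prod>i\<in>UNIV. \<Sum>a\<in>A i. f i a)"
proof -
  have "(\<Prod>i\<in>UNIV. \<Sum>a\<in>A i. f i a) = (\<Sum>p\<in>PiE UNIV A. \<Prod>i\<in>UNIV. f i (p i))"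
    using assms by (simp add: prod_sum_PiE)
  also have "\<dots> = (\<Sum>p | \<forall>i. p $ i \<in> A i. \<Prod>i\<in>UNIV. f i (p $ i))"
    \<comment> \<open>Over \<open>UNIV\<close>, \<open>PiE\<close> puts no condition outside the
      domain, so its elements correspond exactly to vectors.\<close>
    by (rule sum.reindex_bij_witness [of _ vec_nth vec_lambda]) (auto simp: PiE_iff)
  finally show ?thesis ..
qed

theorem theorem2p3:
  fixes m n :: "nat ^ 'N"
    and h :: "int ^ 'N \<Rightarrow> int"
    and x :: "int ^ 'N"
  assumes m: "\<And>i. m $ i \<ge> 3"
    and h: "\<And>y. h y = (\<Prod>i\<in>UNIV. (y $ i) zchoose (m $ i))"
    and n: "\<And>i. n $ i \<ge> 2"
    and less: "\<And>i. n $ i < m $ i"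
  shows "(\<Sum>p\<in>{p :: nat ^ 'N. \<forall>i. 0 \<le> p $ i \<and> p $ i \<le> n $ i}.
            (- 1) ^ (\<Sum>i\<in>UNIV. p $ i) * (\<Prod>i\<in>UNIV. int ((n $ i) choose (p $ i)))
            * h (\<Sum>i\<in>UNIV. (int (n $ i) - int (p $ i) + x $ i) *s axis i 1))
         = (\<Prod>l\<in>UNIV. (x $ l) zchoose (m $ l - n $ l))"
proof -
  let ?f = "\<lambda>i p. (- 1) ^ p * int ((n $ i) choose p)
    * ((int (n $ i) - int p + x $ i) zchoose (m $ i))"
  \<comment> \<open>Thus the \<open>j\<close>-th factor of \<open>h\<close> depends on
    \<open>p\<close> only through \<open>p $ j\<close>.\<close>
  have coord: "(\<Sum>i\<in>UNIV. c i *s axis i 1) $ j = c j" for c :: "'N \<Rightarrow> int" and j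
    by (simp add: axis_def if_distrib cong: if_cong)
  have "(\<Sum>p\<in>{p :: nat ^ 'N. \<forall>i. 0 \<le> p $ i \<and> p $ i \<le> n $ i}.
            (- 1) ^ (\<Sum>i\<in>UNIV. p $ i) * (\<Prod>i\<in>UNIV. int ((n $ i) choose (p $ i)))
            * h (\<Sum>i\<in>UNIV. (int (n $ i) - int (p $ i) + x $ i) *s axis i 1))
      = (\<Sum>p | \<forall>i. p $ i \<in> {..n $ i}. \<Prod>i\<in>UNIV. ?f i (p $ i))"
    \<comment> \<open>The sign also factors, by \<open>power_sum\<close>.\<close>
    by (simp only: h coord prod.distrib power_sum atMost_iff zero_le simp_thms)
  also have "\<dots> = (\<Prod>i\<in>UNIV. \<Sum>p\<le>n $ i. ?f i p)"
    by (rule sum_vec_prod) simp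
  also have "\<dots> = (\<Prod>l\<in>UNIV. (x $ l) zchoose (m $ l - n $ l))"
    using less by (simp add: binomial_difference_int_gbinomial less_imp_le)
  finally show ?thesis .
qed

end
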